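(* Let $N\ge 2$, $\omega\in\mathbb{R}$, and let $g:\mathbb{R}\to\mathbb{R}$ be a smooth $2\pi$-periodic function that is even, i.e. $g(\varphi)=g(-\varphi)$ for all $\varphi$. Then the flow on $\mathbb{T}^N$ of $$\frac{d}{dt}\theta_k=F_k(\theta):=\omega+\frac1N\sum_{j=1}^N g(\theta_k-\theta_j),\qquad k=1,\dots,N,$$ is divergence free, i.e. $\sum_{k=1}^N\frac{\partial F_k}{\partial\theta_k}=0$ at every point of $\mathbb{T}^N$. Moreover, the reduced system for the phase differences on $\mathbb{T}^{N-1}$ is also divergence free.
   Context: $\mathbb{T}=\mathbb{R}/2\pi\mathbb{Z}$. The vector field $F$ is equivariant under the diagonal translations $\theta\mapsto\theta+(s,\dots,s)$, $s\in\mathbb{T}$. The reduced system is the induced flow $\frac{d}{dt}\tilde\theta=\tilde F(\tilde\theta)$ on the quotient $\mathbb{T}^N/\mathbb{T}\cong\mathbb{T}^{N-1}$ by these translations (the dynamics of phase differences); concretely, one may use the coordinates $\psi_k=\theta_k-\theta_1$, $k=2,\dots,N$, for which $\frac{d}{dt}\psi_k=F_k-F_1$, which depends only on $\psi_2,\dots,\psi_N$ (the divergence does not depend on the choice of linear coordinates for the phase differences). *)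

theory Defs
  imports "HOL-Analysis.Analysis" "HOL-Library.Real_Mod"
begin

quotient_type circle = real / "\<lambda>x y. [x = y] (rmod (2 * pi))"
  morphisms rep_circle angle
  by (rule equivpI) (auto intro!: reflpI sympI transpI intro: rcong_sym rcong_trans)

instantiation circle :: ab_group_add
begin

lift_definition zero_circle :: circle is 0 .

lift_definition plus_circle :: "circle \<Rightarrow> circle \<Rightarrow> circle" is "(+)"
  by (rule rcong_add)

lift_definition minus_circle :: "circle \<Rightarrow> circle \<Rightarrow> circle" is "(-)"
  by (rule rcong_diff)

lift_definition uminus_circle :: "circle \<Rightarrow> circle" is uminus
  by (rule rcong_uminus)

instance
  by standard (transfer; simp add: algebra_simps)+

end

lemma angle_eq_iff: "angle x = angle y \<longleftrightarrow> (\<exists>n::int. y = x + of_int n * (2 * pi))"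
  by (simp add: circle.abs_eq_iff rcong_altdef)

definition periodic_2pi :: "(real \<Rightarrow> real) \<Rightarrow> bool" where
  "periodic_2pi g \<longleftrightarrow> (\<forall>x. g (x + 2 * pi) = g x)"

definition smooth :: "(real \<Rightarrow> real) \<Rightarrow> bool" where
  "smooth g \<longleftrightarrow> (\<forall>n x. (deriv ^^ n) g differentiable (at x))"

(* rep_circle picks an arbitrary representative; for periodic g the choice is irrelevant,
   see on_circle_angle below. *)
definition on_circle :: "(real \<Rightarrow> real) \<Rightarrow> circle \<Rightarrow> real" where
  "on_circle g x = g (rep_circle x)"

lemma on_circle_angle:
  assumes "periodic_2pi g"
  shows "on_circle g (angle x) = g x"
proof -
  have nat: "g (y + of_nat n * (2 * pi)) = g y" for y and n :: nat
  proof (induction n)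
    case (Suc n)
    have "g (y + of_nat (Suc n) * (2 * pi)) = g ((y + of_nat n * (2 * pi)) + 2 * pi)"
      by (simp add: algebra_simps)
    then show ?case
      using assms Suc by (simp add: periodic_2pi_def)
  qed simp
  have int: "g (y + of_int n * (2 * pi)) = g y" for y and n :: int
  proof (cases "n \<ge> 0")
    case True
    then show ?thesis using nat[of y "nat n"] by simp
  next
    case False
    then show ?thesis using nat[of "y + of_int n * (2 * pi)" "nat (- n)"] by simp
  qed
  have "angle (rep_circle (angle x)) = angle x"
    by (meson Quotient3_abs_rep Quotient3_circle)
  then obtain n :: int where "x = rep_circle (angle x) + of_int n * (2 * pi)"
    unfolding angle_eq_iff by blast
  then show ?thesis
    unfolding on_circle_def using int[of "rep_circle (angle x)" n] by metis
qed

(* A point of the torus with coordinates labelled by a finite set I is a function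
   nat => circle of which only the values on I matter; a vector field assigns to such a point
   its real components, again relevant on I only. *)

definition has_partial_derivative ::
    "((nat \<Rightarrow> circle) \<Rightarrow> real) \<Rightarrow> nat \<Rightarrow> (nat \<Rightarrow> circle) \<Rightarrow> real \<Rightarrow> bool" where
  "has_partial_derivative f k \<theta> D \<longleftrightarrow>
     ((\<lambda>t. f (\<theta>(k := \<theta> k + angle t))) has_real_derivative D) (at 0)"

definition has_divergence ::
    "nat set \<Rightarrow> ((nat \<Rightarrow> circle) \<Rightarrow> nat \<Rightarrow> real) \<Rightarrow> (nat \<Rightarrow> circle) \<Rightarrow> real \<Rightarrow> bool" where
  "has_divergence I F \<theta> d \<longleftrightarrow>
     (\<exists>D. (\<forall>k\<in>I. has_partial_derivative (\<lambda>\<eta>. F \<eta> k) k \<theta> (D k)) \<and> d = (\<Sum>k\<in>I. D k))"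

definition divergence_free :: "nat set \<Rightarrow> ((nat \<Rightarrow> circle) \<Rightarrow> nat \<Rightarrow> real) \<Rightarrow> bool" where
  "divergence_free I F \<longleftrightarrow> (\<forall>\<theta>. has_divergence I F \<theta> 0)"

definition coupled_field ::
    "nat \<Rightarrow> real \<Rightarrow> (real \<Rightarrow> real) \<Rightarrow> (nat \<Rightarrow> circle) \<Rightarrow> nat \<Rightarrow> real" where
  "coupled_field N \<omega> g \<theta> k = \<omega> + (1 / real N) * (\<Sum>j=1..N. on_circle g (\<theta> k - \<theta> j))"

(* The field induced on the quotient by diagonal translations, in the coordinates
   \<psi> k = \<theta> k - \<theta> 1 for k \<ge> 2: each orbit is represented by its point with \<theta> 1 = 0. *)
definition reduced_field ::
    "((nat \<Rightarrow> circle) \<Rightarrow> nat \<Rightarrow> real) \<Rightarrow> (nat \<Rightarrow> circle) \<Rightarrow> nat \<Rightarrow> real" where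
  "reduced_field F \<psi> k = F (\<psi>(1 := 0)) k - F (\<psi>(1 := 0)) 1"

lemma coupled_field_translate:
  "coupled_field N \<omega> g (\<lambda>j. \<theta> j + s) k = coupled_field N \<omega> g \<theta> k"
  by (simp add: coupled_field_def)

lemma reduced_field_coupled_field:
  assumes "\<And>j. j \<in> {2..N} \<Longrightarrow> \<psi> j = \<theta> j - \<theta> 1" and "k \<in> {2..N}"
  shows "reduced_field (coupled_field N \<omega> g) \<psi> k =
           coupled_field N \<omega> g \<theta> k - coupled_field N \<omega> g \<theta> 1"
proof -
  have *: "(\<psi>(1 := 0)) j = \<theta> j - \<theta> 1" if "j \<in> {1..N}" for j
    using assms(1)[of j] that by (cases "j = 1") auto
  have "coupled_field N \<omega> g (\<psi>(1 := 0)) i = coupled_field N \<omega> g \<theta> i" if "i \<in> {1..N}" for i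
    unfolding coupled_field_def using that
    by (intro arg_cong2[where f = "(+)"] arg_cong2[where f = "(*)"] sum.cong refl)
       (simp only: *, simp)
  then show ?thesis
    using assms(2) by (simp add: reduced_field_def)
qed

end

theory Submission
  imports Defs
begin

text \<open>
  Write \<open>h\<close> for the derivative of \<open>g\<close>, regarded as a function on the circle; since \<open>g\<close> is even,
  \<open>h\<close> is odd. In the sum defining \<open>F\<^sub>k\<close> the term with \<open>j = k\<close> is the constant \<open>g 0\<close>, while each
  other term contributes \<open>h (\<theta>\<^sub>k - \<theta>\<^sub>j) / N\<close> to \<open>\<partial>F\<^sub>k/\<partial>\<theta>\<^sub>k\<close>. As \<open>h 0 = 0\<close>, the term \<open>j = k\<close> may be
  included in the same formula, so the divergence is \<open>1/N\<close> times the sum of \<open>h (\<theta>\<^sub>k - \<theta>\<^sub>j)\<close> over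
  all ordered pairs \<open>(k, j)\<close>. This is the sum of the entries of an antisymmetric matrix, hence zero.

  For the reduced field, the divergence at \<open>\<psi>\<close> is the sum of \<open>\<partial>F\<^sub>k/\<partial>\<theta>\<^sub>k - \<partial>F\<^sub>1/\<partial>\<theta>\<^sub>k\<close> over
  \<open>k \<ge> 2\<close>, taken at the representative with \<open>\<theta>\<^sub>1 = 0\<close>. Because \<open>F\<^sub>1\<close> is invariant under diagonal
  translations, its partial derivatives add up to zero, so the subtracted terms together restore
  exactly the missing \<open>\<partial>F\<^sub>1/\<partial>\<theta>\<^sub>1\<close>: the reduced divergence equals the full one.
\<close>

section \<open>Differentiating functions on the circle\<close>

lemma angle_rep_circle: "angle (rep_circle x) = x"
  by (meson Quotient3_abs_rep Quotient3_circle)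

lemma angle_add: "angle x + angle y = angle (x + y)"
  by (rule plus_circle.abs_eq)

lemma angle_minus: "- angle x = angle (- x)"
  by (rule uminus_circle.abs_eq)

lemma periodic_2pi_deriv:
  assumes "periodic_2pi g"
  shows "periodic_2pi (deriv g)"
  unfolding periodic_2pi_def
proof
  fix x
  have "(\<lambda>y. g (y + 2 * pi)) = g"
    using assms by (auto simp: periodic_2pi_def)
  then show "deriv g (x + 2 * pi) = deriv g x"
    unfolding deriv_def using DERIV_shift[of g _ x "2 * pi"] by simp
qed

lemma deriv_odd_if_even:
  fixes g :: "real \<Rightarrow> real"
  assumes "\<And>x. g x = g (- x)" and "\<And>x. g differentiable (at x)"
  shows "deriv g (- x) = - deriv g x"
proof -
  have "(\<lambda>y. g (- y)) = g"
    by (simp add: fun_eq_iff assms(1)[symmetric])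
  moreover have "(g has_real_derivative deriv g (- x)) (at (- x))"
    using assms(2) by (simp add: DERIV_deriv_iff_real_differentiable)
  ultimately have "(g has_real_derivative - deriv g (- x)) (at x)"
    using DERIV_mirror[of g "deriv g (- x)" x] by simp
  then show ?thesis
    by (simp add: DERIV_imp_deriv)
qed

text \<open>Oddness passes from the line to the circle although the representative of \<open>- x\<close> need not be
  the negative of the representative of \<open>x\<close>: periodicity makes the choice immaterial.\<close>

lemma on_circle_odd:
  assumes "periodic_2pi h" and "\<And>x. h (- x) = - h x"
  shows "on_circle h (- x) = - on_circle h x"
proof -
  have "on_circle h (- angle y) = - on_circle h (angle y)" for y
    using assms by (simp add: angle_minus on_circle_angle)
  then show ?thesis
    by (metis angle_rep_circle)
qed

lemma on_circle_has_derivative: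
  assumes "periodic_2pi g" and "\<And>x. g differentiable (at x)"
  shows "((\<lambda>t. on_circle g (x + angle t)) has_real_derivative on_circle (deriv g) x) (at 0)"
proof -
  have "on_circle g (x + angle t) = g (t + rep_circle x)" for t
    using on_circle_angle[OF assms(1), of "t + rep_circle x"]
    by (simp add: angle_add[symmetric] angle_rep_circle add.commute)
  moreover have "((\<lambda>t. g (t + rep_circle x)) has_real_derivative deriv g (rep_circle x)) (at 0)"
    using assms(2) DERIV_shift[of g "deriv g (rep_circle x)" 0 "rep_circle x"]
    by (simp add: DERIV_deriv_iff_real_differentiable[symmetric])
  ultimately show ?thesis
    by (simp add: on_circle_def)
qed

lemma on_circle_has_derivative_minus:
  assumes "periodic_2pi g" and "\<And>x. g differentiable (at x)"
  shows "((\<lambda>t. on_circle g (x - angle t)) has_real_derivative - on_circle (deriv g) x) (at 0)"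
  using DERIV_mirror[of "\<lambda>t. on_circle g (x + angle t)" _ 0]
    on_circle_has_derivative[OF assms, of x]
  by (simp add: angle_minus[symmetric])

section \<open>Partial derivatives of the coupled field\<close>

text \<open>The oddness of the derivative gives it the value zero at the origin, so the constant
  self-coupling term fits the formula of the other terms and the sum needs no exception.\<close>

lemma coupled_field_diagonal_derivative:
  assumes "periodic_2pi g" and "\<And>x. g differentiable (at x)" and "\<And>x. g x = g (- x)"
  shows "has_partial_derivative (\<lambda>\<eta>. coupled_field N \<omega> g \<eta> k) k \<theta>
           ((1 / real N) * (\<Sum>j=1..N. on_circle (deriv g) (\<theta> k - \<theta> j)))"
proof -
  let ?\<theta> = "\<lambda>t. \<theta>(k := \<theta> k + angle t)"
  have zero: "on_circle (deriv g) 0 = 0"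
    using on_circle_odd[OF periodic_2pi_deriv[OF assms(1)] deriv_odd_if_even[OF assms(3,2)], of 0]
    by simp
  have "((\<lambda>t. on_circle g (?\<theta> t k - ?\<theta> t j)) has_real_derivative
          on_circle (deriv g) (\<theta> k - \<theta> j)) (at 0)" for j
  proof (cases "j = k")
    case True
    then show ?thesis
      by (simp add: zero)
  next
    case False
    then show ?thesis
      using on_circle_has_derivative[OF assms(1,2), of "\<theta> k - \<theta> j"]
      by (simp add: algebra_simps)
  qed
  then show ?thesis
    unfolding has_partial_derivative_def coupled_field_def
    by (intro DERIV_cong[OF DERIV_add[OF DERIV_const DERIV_cmult[OF DERIV_sum]]]) auto
qed

lemma coupled_field_off_diagonal_derivative:
  assumes "periodic_2pi g" and "\<And>x. g differentiable (at x)"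
    and "k \<in> {1..N}" and "i \<noteq> k"
  shows "has_partial_derivative (\<lambda>\<eta>. coupled_field N \<omega> g \<eta> i) k \<theta>
           (- (1 / real N) * on_circle (deriv g) (\<theta> i - \<theta> k))"
proof -
  let ?\<theta> = "\<lambda>t. \<theta>(k := \<theta> k + angle t)"
  have "((\<lambda>t. on_circle g (?\<theta> t i - ?\<theta> t j)) has_real_derivative
          (if j = k then - on_circle (deriv g) (\<theta> i - \<theta> k) else 0)) (at 0)" for j
    using on_circle_has_derivative_minus[OF assms(1,2), of "\<theta> i - \<theta> k"] assms(4)
    by (simp add: algebra_simps)
  then have "has_partial_derivative (\<lambda>\<eta>. coupled_field N \<omega> g \<eta> i) k \<theta>
      (0 + (1 / real N) * (\<Sum>j=1..N. if j = k then - on_circle (deriv g) (\<theta> i - \<theta> k) else 0))"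
    unfolding has_partial_derivative_def coupled_field_def
    by (intro DERIV_add[OF DERIV_const DERIV_cmult[OF DERIV_sum]])
  then show ?thesis
    using assms(3) by simp
qed

section \<open>The divergence\<close>

lemma sum_antisymmetric_eq_0:
  fixes a :: "'i \<Rightarrow> 'i \<Rightarrow> real"
  assumes "\<And>i j. a i j = - a j i"
  shows "(\<Sum>i\<in>I. \<Sum>j\<in>I. a i j) = 0"
proof -
  have "(\<Sum>i\<in>I. \<Sum>j\<in>I. a i j) = (\<Sum>i\<in>I. \<Sum>j\<in>I. a j i)"
    by (rule sum.swap)
  also have "\<dots> = (\<Sum>i\<in>I. \<Sum>j\<in>I. - a i j)"
    by (intro sum.cong refl assms)
  also have "\<dots> = - (\<Sum>i\<in>I. \<Sum>j\<in>I. a i j)"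
    by (simp add: sum_negf)
  finally show ?thesis
    by simp
qed

theorem lemma3:
  fixes N :: nat and \<omega> :: real and g :: "real \<Rightarrow> real"
  assumes "N \<ge> 2"
    and "smooth g"
    and "periodic_2pi g"
    and "\<And>\<phi>. g \<phi> = g (- \<phi>)"
  shows "divergence_free {1..N} (coupled_field N \<omega> g) \<and>
         divergence_free {2..N} (reduced_field (coupled_field N \<omega> g))"
proof -
  let ?F = "coupled_field N \<omega> g"
  let ?h = "on_circle (deriv g)"
  define D where "D \<theta> k = (1 / real N) * (\<Sum>j=1..N. ?h (\<theta> k - \<theta> j))" for \<theta> and k :: nat
  have diff: "g differentiable (at x)" for x
    using assms(2) unfolding smooth_def by (metis funpow_0)
  have odd: "?h (- x) = - ?h x" for x
    by (rule on_circle_odd[OF periodic_2pi_deriv[OF assms(3)] deriv_odd_if_even[OF assms(4) diff]])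
  have D: "has_partial_derivative (\<lambda>\<eta>. ?F \<eta> k) k \<theta> (D \<theta> k)" for k \<theta>
    unfolding D_def by (rule coupled_field_diagonal_derivative[OF assms(3) diff assms(4)])
  have sum_D: "(\<Sum>k=1..N. D \<theta> k) = 0" for \<theta>
  proof -
    have "?h (\<theta> k - \<theta> j) = - ?h (\<theta> j - \<theta> k)" for k j
      using odd[of "\<theta> j - \<theta> k"] by simp
    from sum_antisymmetric_eq_0[of "\<lambda>k j. ?h (\<theta> k - \<theta> j)", OF this] show ?thesis
      unfolding D_def sum_distrib_left[symmetric] by simp
  qed
  have "has_divergence {1..N} ?F \<theta> 0" for \<theta>
    unfolding has_divergence_def using D sum_D[of \<theta>] by (intro exI[of _ "D \<theta>"]) auto
  moreover have "has_divergence {2..N} (reduced_field ?F) \<psi> 0" for \<psi>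
  proof -
    define \<theta> where "\<theta> = \<psi>(1 := 0)"
    define R where "R k = D \<theta> k + (1 / real N) * ?h (\<theta> 1 - \<theta> k)" for k
    have "has_partial_derivative (\<lambda>\<eta>. reduced_field ?F \<eta> k) k \<psi> (R k)" if "k \<in> {2..N}" for k
    proof -
      have "k \<in> {1..N}" and "1 \<noteq> k"
        using that by auto
      note off = coupled_field_off_diagonal_derivative[OF assms(3) diff this, of \<omega> \<theta>]
      \<comment> \<open>Moving a coordinate other than the first commutes with the normalisation
        \<open>\<theta>\<^sub>1 = 0\<close>.\<close>
      have "(\<psi>(k := \<psi> k + angle t))(1 := 0) = \<theta>(k := \<theta> k + angle t)" for t
        using \<open>1 \<noteq> k\<close> by (auto simp: \<theta>_def fun_eq_iff)
      then show ?thesis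
        using DERIV_diff[OF D[of k \<theta>, unfolded has_partial_derivative_def]
            off[unfolded has_partial_derivative_def]]
        by (simp add: has_partial_derivative_def reduced_field_def R_def)
    qed
    moreover have "(\<Sum>k=2..N. R k) = 0"
    proof -
      have split: "{1..N} = insert 1 {2..N}"
        using assms(1) by auto
      have "?h 0 = 0"
        using odd[of 0] by simp
      \<comment> \<open>The contributions of \<open>- F\<^sub>1\<close> amount to the diagonal derivative of \<open>F\<^sub>1\<close>, as
        translation invariance predicts.\<close>
      then have "D \<theta> 1 = (\<Sum>k=2..N. (1 / real N) * ?h (\<theta> 1 - \<theta> k))"
        unfolding D_def split by (simp add: sum_distrib_left)
      then have "(\<Sum>k=2..N. R k) = (\<Sum>k=1..N. D \<theta> k)"
        unfolding R_def split by (simp add: sum.distrib)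
      then show ?thesis
        using sum_D by simp
    qed
    ultimately show ?thesis
      unfolding has_divergence_def by (intro exI[of _ R]) auto
  qed
  ultimately show ?thesis
    by (simp add: divergence_free_def)
qed

end
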